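(* Let $\mathcal{X}$ be a non-empty finite set, let $N\geq1$, let $\mathcal{K}\subseteq\mathcal{L}(\mathcal{X}^N)$ and let $\underline{P}$ be a lower prevision on $\mathcal{K}$. Let $\mathcal{H}:=\{\mathrm{MuHy}^N(f|\cdot):f\in\mathcal{K}\}\subseteq\mathcal{L}(\mathcal{N}^N)$, and for $g\in\mathcal{H}$ let $$\underline{Q}(g):=\sup\{\underline{P}(f):f\in\mathcal{K},\ \mathrm{MuHy}^N(f|\cdot)=g\}.$$ There are exchangeable coherent lower previsions on $\mathcal{L}(\mathcal{X}^N)$ that dominate $\underline{P}$ on $\mathcal{K}$ if and only if $\underline{Q}$ is a lower prevision on $\mathcal{H}$ (that is, $\underline{Q}$ is nowhere infinite) that avoids sure loss. In that case the exchangeable natural extension $\underline{E}_{\underline{P},\mathcal{P}_N}$ of $\underline{P}$ satisfies $$\underline{E}_{\underline{P},\mathcal{P}_N}(f)=\underline{E}_{\underline{Q}}(\mathrm{MuHy}^N(f|\cdot))\quad\text{for all }f\in\mathcal{L}(\mathcal{X}^N),$$ i.e., the count distribution of the exchangeable natural extension of $\underline{P}$ is the natural extension $\underline{E}_{\underline{Q}}$ of the lower prevision $\underline{Q}$.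
   Context: A gamble on a non-empty set $\mathcal{Z}$ is a bounded map $\mathcal{Z}\to\mathbb{R}$; $\mathcal{L}(\mathcal{Z})$ is the linear space of all gambles on $\mathcal{Z}$. A lower prevision on a set of gambles is a real-valued functional on it. A lower prevision on $\mathcal{L}(\mathcal{Z})$ is coherent iff for all $f,g\in\mathcal{L}(\mathcal{Z})$ and real $\lambda\geq0$: $\underline{P}(f)\geq\inf f$; $\underline{P}(\lambda f)=\lambda\underline{P}(f)$; $\underline{P}(f+g)\geq\underline{P}(f)+\underline{P}(g)$. A lower prevision $\underline{Q}$ on a set $\mathcal{H}\subseteq\mathcal{L}(\mathcal{Z})$ avoids sure loss if $\sup_{z\in\mathcal{Z}}\sum_{k=1}^n\lambda_k[g_k(z)-\underline{Q}(g_k)]\geq0$ for all natural $n$, all $g_1,\dots,g_n\in\mathcal{H}$ and all real $\lambda_1,\dots,\lambda_n\geq0$. The natural extension of such a $\underline{Q}$ is the point-wise smallest coherent lower prevision on $\mathcal{L}(\mathcal{Z})$ that dominates $\underline{Q}$ on $\mathcal{H}$, given by $$\underline{E}_{\underline{Q}}(h):=\sup\Big\{\inf_{z\in\mathcal{Z}}\Big[h(z)-\sum_{k=1}^n\lambda_k[g_k(z)-\underline{Q}(g_k)]\Big]:n\geq0,\ \lambda_k\geq0,\ g_k\in\mathcal{H}\Big\}.$$ A coherent lower prevision $\underline{P}^N$ on $\mathcal{L}(\mathcal{X}^N)$ is exchangeable if $\underline{P}^N(\pi f-f)\geq0$ for all gambles $f$ on $\mathcal{X}^N$ and all $\pi\in\mathcal{P}_N$,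 the set of permutations of $\{1,\dots,N\}$, where $(\pi f)(x_1,\dots,x_N):=f(x_{\pi(1)},\dots,x_{\pi(N)})$. It dominates $\underline{P}$ on $\mathcal{K}$ if $\underline{P}^N(f)\geq\underline{P}(f)$ for all $f\in\mathcal{K}$. The set of count vectors is $\mathcal{N}^N:=\{\mathbf{m}\in\mathbb{Z}_{\geq0}^{\mathcal{X}}:\sum_{x\in\mathcal{X}}m_x=N\}$. The counting map $\mathbf{T}^N:\mathcal{X}^N\to\mathcal{N}^N$ has components $T^N_x(\mathbf{z}):=|\{k:z_k=x\}|$. For $\mathbf{m}\in\mathcal{N}^N$, $[\mathbf{m}]:=\{\mathbf{z}\in\mathcal{X}^N:\mathbf{T}^N(\mathbf{z})=\mathbf{m}\}$, $\nu(\mathbf{m}):=|[\mathbf{m}]|=N!/\prod_{x}m_x!$, and $\mathrm{MuHy}^N(f|\mathbf{m}):=\frac{1}{\nu(\mathbf{m})}\sum_{\mathbf{z}\in[\mathbf{m}]}f(\mathbf{z})$ for gambles $f$ on $\mathcal{X}^N$. $\mathrm{MuHy}^N(f|\cdot)$ is the corresponding gamble on $\mathcal{N}^N$. The count distribution of an exchangeable coherent lower prevision $\underline{P}^N$ is the coherent lower prevision $h\mapsto\underline{P}^N(h\circ\mathbf{T}^N)$ on $\mathcal{L}(\mathcal{N}^N)$. When there are exchangeable coherent lower previsions on $\mathcal{L}(\mathcal{X}^N)$ dominating $\underline{P}$ on $\mathcal{K}$, the exchangeable natural extension $\underline{E}_{\underline{P},\mathcal{P}_N}$ is the point-wise smallest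 such lower prevision; it is given by $$\underline{E}_{\underline{P},\mathcal{P}_N}(f)=\sup\Big\{\underline{E}_{\mathcal{P}_N}\Big(f-\sum_{k=1}^n\lambda_k[f_k-\underline{P}(f_k)]\Big):n\geq0,\ \lambda_k\geq0,\ f_k\in\mathcal{K}\Big\},$$ where $\underline{E}_{\mathcal{P}_N}(f):=\min_{\mathbf{m}\in\mathcal{N}^N}\mathrm{MuHy}^N(f|\mathbf{m})$. *)

theory Defs
  imports "HOL-Analysis.Analysis" "HOL-Library.FuncSet" "HOL-Combinatorics.Permutations"
begin

section \<open>Lower previsions\<close>

text \<open>
  The space on which gambles live is an explicit set, because \<open>X\<^sup>N\<close> and the set of count vectors
  depend on the number \<open>N\<close>. A map on a set is represented by the function that is
  \<^const>\<open>undefined\<close> outside of that set; the vector space operations on gambles are therefore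
  written with restricted abstractions. A lower prevision on a set of gambles is a function
  of which only the values on that set matter.
\<close>

type_synonym 'z gamble = "'z \<Rightarrow> real"
type_synonym 'z lower_prevision = "'z gamble \<Rightarrow> real"

definition gambles :: "'z set \<Rightarrow> 'z gamble set" where
  "gambles Z = {f \<in> extensional Z. bounded (f ` Z)}"

definition coherent :: "'z set \<Rightarrow> 'z lower_prevision \<Rightarrow> bool" where
  "coherent Z P \<longleftrightarrow>
     (\<forall>f\<in>gambles Z. P f \<ge> (INF z\<in>Z. f z)) \<and>
     (\<forall>f\<in>gambles Z. \<forall>c\<ge>0. P (\<lambda>z\<in>Z. c * f z) = c * P f) \<and>
     (\<forall>f\<in>gambles Z. \<forall>g\<in>gambles Z. P (\<lambda>z\<in>Z. f z + g z) \<ge> P f + P g)"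

definition dominates :: "'z gamble set \<Rightarrow> 'z lower_prevision \<Rightarrow> 'z lower_prevision \<Rightarrow> bool" where
  "dominates K R P \<longleftrightarrow> (\<forall>f\<in>K. R f \<ge> P f)"

definition avoids_sure_loss :: "'z set \<Rightarrow> 'z gamble set \<Rightarrow> 'z lower_prevision \<Rightarrow> bool" where
  "avoids_sure_loss Z H Q \<longleftrightarrow>
     (\<forall>(n::nat) (g :: nat \<Rightarrow> 'z gamble) (c :: nat \<Rightarrow> real).
        (\<forall>k\<in>{1..n}. g k \<in> H \<and> c k \<ge> 0) \<longrightarrow>
        (SUP z\<in>Z. \<Sum>k=1..n. c k * (g k z - Q (g k))) \<ge> 0)"

text \<open>
  The real supremum below is meaningful when \<open>Q\<close> avoids sure loss on \<open>H \<subseteq> gambles Z\<close>, since then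
  the set is bounded above (by \<open>sup h\<close>); it is always non-empty (take \<open>n = 0\<close>).
\<close>

definition natural_extension ::
    "'z set \<Rightarrow> 'z gamble set \<Rightarrow> 'z lower_prevision \<Rightarrow> 'z lower_prevision" where
  "natural_extension Z H Q h =
     Sup {INF z\<in>Z. h z - (\<Sum>k=1..n. c k * (g k z - Q (g k))) |
            (n::nat) (c :: nat \<Rightarrow> real) (g :: nat \<Rightarrow> 'z gamble).
            \<forall>k\<in>{1..n}. c k \<ge> 0 \<and> g k \<in> H}"


section \<open>Exchangeability\<close>

definition samples :: "'a set \<Rightarrow> nat \<Rightarrow> (nat \<Rightarrow> 'a) set" where
  "samples X N = {1..N} \<rightarrow>\<^sub>E X"

text \<open>
  A permutation of \<open>{1..N}\<close> in the sense of \<^const>\<open>permutes\<close> is the identity outside of \<open>{1..N}\<close>, so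
  \<open>z \<circ> \<pi>\<close> is again in \<^term>\<open>samples X N\<close> if \<open>z\<close> is.
\<close>

definition permute_gamble ::
    "'a set \<Rightarrow> nat \<Rightarrow> (nat \<Rightarrow> nat) \<Rightarrow> (nat \<Rightarrow> 'a) gamble \<Rightarrow> (nat \<Rightarrow> 'a) gamble" where
  "permute_gamble X N \<pi> f = (\<lambda>z\<in>samples X N. f (z \<circ> \<pi>))"

definition exchangeable :: "'a set \<Rightarrow> nat \<Rightarrow> (nat \<Rightarrow> 'a) lower_prevision \<Rightarrow> bool" where
  "exchangeable X N P \<longleftrightarrow>
     (\<forall>f\<in>gambles (samples X N). \<forall>\<pi>. \<pi> permutes {1..N} \<longrightarrow>
        P (\<lambda>z\<in>samples X N. permute_gamble X N \<pi> f z - f z) \<ge> 0)"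

definition dominating_exchangeable ::
    "'a set \<Rightarrow> nat \<Rightarrow> (nat \<Rightarrow> 'a) gamble set \<Rightarrow> (nat \<Rightarrow> 'a) lower_prevision
       \<Rightarrow> (nat \<Rightarrow> 'a) lower_prevision set" where
  "dominating_exchangeable X N K P =
     {R. coherent (samples X N) R \<and> exchangeable X N R \<and> dominates K R P}"

text \<open>
  \<open>E\<close> is the point-wise smallest exchangeable coherent lower prevision dominating \<open>P\<close> on \<open>K\<close>. Its
  values on \<^term>\<open>gambles (samples X N)\<close> are uniquely determined by this.
\<close>

definition is_exchangeable_natural_extension ::
    "'a set \<Rightarrow> nat \<Rightarrow> (nat \<Rightarrow> 'a) gamble set \<Rightarrow> (nat \<Rightarrow> 'a) lower_prevision
       \<Rightarrow> (nat \<Rightarrow> 'a) lower_prevision \<Rightarrow> bool" where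
  "is_exchangeable_natural_extension X N K P E \<longleftrightarrow>
     E \<in> dominating_exchangeable X N K P \<and>
     (\<forall>R\<in>dominating_exchangeable X N K P. \<forall>f\<in>gambles (samples X N). E f \<le> R f)"


section \<open>Count vectors\<close>

definition count_vectors :: "'a set \<Rightarrow> nat \<Rightarrow> ('a \<Rightarrow> nat) set" where
  "count_vectors X N = {m \<in> X \<rightarrow>\<^sub>E UNIV. (\<Sum>x\<in>X. m x) = N}"

definition counting_map :: "'a set \<Rightarrow> nat \<Rightarrow> (nat \<Rightarrow> 'a) \<Rightarrow> ('a \<Rightarrow> nat)" where
  "counting_map X N z = (\<lambda>x\<in>X. card {k \<in> {1..N}. z k = x})"

definition count_class :: "'a set \<Rightarrow> nat \<Rightarrow> ('a \<Rightarrow> nat) \<Rightarrow> (nat \<Rightarrow> 'a) set" where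
  "count_class X N m = {z \<in> samples X N. counting_map X N z = m}"

definition MuHy :: "'a set \<Rightarrow> nat \<Rightarrow> (nat \<Rightarrow> 'a) gamble \<Rightarrow> ('a \<Rightarrow> nat) gamble" where
  "MuHy X N f =
     (\<lambda>m\<in>count_vectors X N. (1 / real (card (count_class X N m))) * (\<Sum>z\<in>count_class X N m. f z))"

definition count_distribution ::
    "'a set \<Rightarrow> nat \<Rightarrow> (nat \<Rightarrow> 'a) lower_prevision \<Rightarrow> ('a \<Rightarrow> nat) lower_prevision" where
  "count_distribution X N P h = P (\<lambda>z\<in>samples X N. h (counting_map X N z))"

text \<open>
  The induced assessment on count gambles: the supremum is taken in the extended reals,
  so that it being finite is a meaningful condition.
\<close>

definition count_domain :: "'a set \<Rightarrow> nat \<Rightarrow> (nat \<Rightarrow> 'a) gamble set \<Rightarrow> ('a \<Rightarrow> nat) gamble set" where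
  "count_domain X N K = MuHy X N ` K"

definition count_assessment ::
    "'a set \<Rightarrow> nat \<Rightarrow> (nat \<Rightarrow> 'a) gamble set \<Rightarrow> (nat \<Rightarrow> 'a) lower_prevision
       \<Rightarrow> ('a \<Rightarrow> nat) gamble \<Rightarrow> ereal" where
  "count_assessment X N K P g = (SUP f\<in>{f \<in> K. MuHy X N f = g}. ereal (P f))"

definition count_lower_prevision ::
    "'a set \<Rightarrow> nat \<Rightarrow> (nat \<Rightarrow> 'a) gamble set \<Rightarrow> (nat \<Rightarrow> 'a) lower_prevision
       \<Rightarrow> ('a \<Rightarrow> nat) lower_prevision" where
  "count_lower_prevision X N K P g = real_of_ereal (count_assessment X N K P g)"

end

theory Submission
  imports Defs
begin

text \<open>
  Write \<open>T\<close> for the counting map. An exchangeable coherent lower prevision \<open>R\<close> on samples contains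
  nothing beyond its count distribution. The reason is that the average of \<open>\<pi> f\<close> over all
  permutations \<open>\<pi>\<close> is the gamble \<open>MuHy(f|T)\<close>: permutations act transitively on each count class
  (\<open>same_counts_imp_permutation\<close>), so averaging over the group is averaging over the class
  (\<open>MuHy_counting_map_eq_average\<close>). Since \<open>R (\<pi> f - f) \<ge> 0\<close>, superadditivity gives
  \<open>R (MuHy(f|T) - f) \<ge> 0\<close>; applying this to \<open>f\<close> and to \<open>-f\<close> yields \<open>R f = R (MuHy(f|T))\<close>
  (\<open>exchangeable_eq_count_distribution\<close>).

  Conversely, \<open>f \<mapsto> Q' (MuHy f)\<close> is coherent and exchangeable whenever \<open>Q'\<close> is coherent on count
  gambles, because \<open>MuHy\<close> is linear, does not lower the infimum, and kills \<open>\<pi> f - f\<close>. As \<open>MuHy\<close> is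
  a left inverse of \<open>h \<mapsto> h \<circ> T\<close>, the two constructions are inverse to each other and respect the
  point-wise order. Under this correspondence, dominating \<open>P\<close> on \<open>K\<close> means that for each count
  gamble \<open>g\<close> the value \<open>Q' g\<close> is at least every \<open>P f\<close> with \<open>MuHy f = g\<close>, hence at least their
  supremum. So a dominating \<open>R\<close> exists iff these suprema are finite and a coherent \<open>Q'\<close> dominates
  them.

  It remains to know, for an arbitrary non-empty space, that an assessment has a dominating coherent
  extension iff it avoids sure loss, and that the least one is the natural extension
  (\<open>coherent_dominating_avoids_sure_loss\<close>, \<open>natural_extension_coherent\<close>,
  \<open>natural_extension_dominates\<close>, \<open>natural_extension_least\<close>).
\<close>

section \<open>Gambles and coherent lower previsions\<close>

lemma gambles_iff:
  "f \<in> gambles Z \<longleftrightarrow> f \<in> extensional Z \<and> (\<exists>B. \<forall>z\<in>Z. \<bar>f z\<bar> \<le> B)"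
  by (auto simp: gambles_def bounded_iff)

lemma gambles_finite: "finite Z \<Longrightarrow> gambles Z = extensional Z"
  by (auto simp: gambles_def finite_imp_bounded)

lemma gambles_add:
  assumes "f \<in> gambles Z" "g \<in> gambles Z"
  shows "(\<lambda>z\<in>Z. f z + g z) \<in> gambles Z"
proof -
  obtain B C where "\<forall>z\<in>Z. \<bar>f z\<bar> \<le> B" "\<forall>z\<in>Z. \<bar>g z\<bar> \<le> C"
    using assms by (auto simp: gambles_iff)
  then have "\<forall>z\<in>Z. \<bar>f z + g z\<bar> \<le> B + C" by (smt (verit))
  then show ?thesis by (auto simp: gambles_iff)
qed

lemma gambles_scale:
  assumes "f \<in> gambles Z"
  shows "(\<lambda>z\<in>Z. c * f z) \<in> gambles Z"
proof -
  obtain B where "\<forall>z\<in>Z. \<bar>f z\<bar> \<le> B"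
    using assms by (auto simp: gambles_iff)
  then have "\<forall>z\<in>Z. \<bar>c * f z\<bar> \<le> \<bar>c\<bar> * B" by (simp add: abs_mult mult_left_mono)
  then show ?thesis by (auto simp: gambles_iff)
qed

lemma gambles_diff:
  assumes "f \<in> gambles Z" "g \<in> gambles Z"
  shows "(\<lambda>z\<in>Z. f z - g z) \<in> gambles Z"
proof -
  have "(\<lambda>z\<in>Z. f z - g z) = (\<lambda>z\<in>Z. f z + (\<lambda>z\<in>Z. (-1) * g z) z)" by auto
  then show ?thesis using gambles_add[OF assms(1) gambles_scale[OF assms(2), of "-1"]] by simp
qed

lemma gambles_const: "(\<lambda>z\<in>Z. a) \<in> gambles Z"
  by (auto simp: gambles_iff)

lemma gambles_sum:
  assumes "\<And>k. k \<in> A \<Longrightarrow> F k \<in> gambles Z"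
  shows "(\<lambda>z\<in>Z. \<Sum>k\<in>A. F k z) \<in> gambles Z"
  using assms
proof (induction A rule: infinite_finite_induct)
  case (insert k A)
  have "(\<lambda>z\<in>Z. \<Sum>k\<in>insert k A. F k z) = (\<lambda>z\<in>Z. F k z + (\<lambda>z\<in>Z. \<Sum>k\<in>A. F k z) z)"
    using insert.hyps by auto
  also have "\<dots> \<in> gambles Z" using insert by (intro gambles_add) auto
  finally show ?case .
qed (simp_all add: gambles_const)

lemma gambles_bdd:
  assumes "f \<in> gambles Z"
  shows "bdd_below (f ` Z)" "bdd_above (f ` Z)"
  using assms by (auto simp: gambles_def bounded_imp_bdd_below bounded_imp_bdd_above)

lemma coherent_sum:
  assumes "Z \<noteq> {}" "coherent Z R" "finite A" "\<And>k. k \<in> A \<Longrightarrow> F k \<in> gambles Z"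
  shows "(\<Sum>k\<in>A. R (F k)) \<le> R (\<lambda>z\<in>Z. \<Sum>k\<in>A. F k z)"
  using assms(3,4)
proof (induction A)
  case empty
  have "(INF z\<in>Z. (\<lambda>z\<in>Z. 0) z) \<le> R (\<lambda>z\<in>Z. 0)"
    using assms(2) gambles_const unfolding coherent_def by blast
  moreover have "(INF z\<in>Z. (\<lambda>z\<in>Z. 0) z) = (0::real)" using assms(1) by simp
  ultimately show ?case by (simp only: sum.empty)
next
  case (insert k A)
  let ?S = "\<lambda>z\<in>Z. \<Sum>k\<in>A. F k z"
  have eq: "(\<lambda>z\<in>Z. \<Sum>k\<in>insert k A. F k z) = (\<lambda>z\<in>Z. F k z + ?S z)"
    using insert.hyps by auto
  have "?S \<in> gambles Z" "F k \<in> gambles Z" using insert.prems by (auto intro!: gambles_sum)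
  then have "R (F k) + R ?S \<le> R (\<lambda>z\<in>Z. F k z + ?S z)"
    using assms(2) unfolding coherent_def by blast
  moreover have "(\<Sum>k\<in>A. R (F k)) \<le> R ?S" using insert by blast
  ultimately have "R (F k) + (\<Sum>k\<in>A. R (F k)) \<le> R (\<lambda>z\<in>Z. F k z + ?S z)" by linarith
  then show ?case using sum.insert[OF insert.hyps, of "\<lambda>k. R (F k)"] unfolding eq by linarith
qed

lemma coherent_zero:
  assumes "coherent Z R"
  shows "R (\<lambda>z\<in>Z. 0) = 0"
proof -
  have "R (\<lambda>z\<in>Z. 0 * (\<lambda>z\<in>Z. 0) z) = 0 * R (\<lambda>z\<in>Z. 0)"
    using assms gambles_const unfolding coherent_def by blast
  then show ?thesis by (simp cong: restrict_cong)
qed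

text \<open>
  The upper bound comes from the lower bound for \<open>-f\<close>, as superadditivity gives
  \<open>R f + R (-f) \<le> R 0 = 0\<close>.
\<close>

lemma coherent_le_SUP:
  assumes "Z \<noteq> {}" "coherent Z R" "f \<in> gambles Z"
  shows "R f \<le> (SUP z\<in>Z. f z)"
proof -
  let ?n = "\<lambda>z\<in>Z. (-1) * f z"
  have n: "?n \<in> gambles Z" using assms(3) by (rule gambles_scale)
  have "R f + R ?n \<le> R (\<lambda>z\<in>Z. f z + ?n z)" "(INF z\<in>Z. ?n z) \<le> R ?n"
    using assms(2,3) n unfolding coherent_def by blast+
  moreover have "R (\<lambda>z\<in>Z. f z + ?n z) = 0"
    using coherent_zero[OF assms(2)] by (simp cong: restrict_cong)
  moreover have "- (SUP z\<in>Z. f z) \<le> (INF z\<in>Z. ?n z)"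
    using assms(1) gambles_bdd(2)[OF assms(3)] by (intro cINF_greatest) (auto intro: cSUP_upper)
  ultimately show ?thesis by linarith
qed

text \<open>
  This is superadditivity for \<open>g = f + (g - f)\<close>. It serves as a comparison principle:
  a lower bound \<open>a\<close> on the price of the gain \<open>g - f\<close> transfers to the prices of \<open>f\<close> and \<open>g\<close>.
\<close>

lemma coherent_add_diff_le:
  assumes "Z \<noteq> {}" "coherent Z R" "f \<in> gambles Z" "g \<in> gambles Z"
    and "R (\<lambda>z\<in>Z. g z - f z) \<ge> a"
  shows "R f + a \<le> R g"
proof -
  have "(\<lambda>z\<in>Z. f z + (\<lambda>z\<in>Z. g z - f z) z) = g"
    using assms(4) by (auto simp: gambles_iff extensional_def)
  moreover have "R f + R (\<lambda>z\<in>Z. g z - f z) \<le> R (\<lambda>z\<in>Z. f z + (\<lambda>z\<in>Z. g z - f z) z)"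
    using assms(2) assms(3) gambles_diff[OF assms(4,3)] unfolding coherent_def by blast
  ultimately show ?thesis using assms(5) by simp
qed


section \<open>Natural extension\<close>

text \<open>
  The gains \<open>S\<close> that can be built from the assessment \<open>Q\<close> form a convex cone. Avoiding sure loss and
  natural extension depend on \<open>Q\<close> only through this cone; with it, gains are added instead of
  concatenating sequences of gambles and coefficients.
\<close>

definition gain_cone :: "'z set \<Rightarrow> 'z gamble set \<Rightarrow> 'z lower_prevision \<Rightarrow> 'z gamble set" where
  "gain_cone Z H Q =
     {\<lambda>z\<in>Z. \<Sum>k=1..n. c k * (g k z - Q (g k)) | (n::nat) (c :: nat \<Rightarrow> real) g.
        \<forall>k\<in>{1..n}. c k \<ge> 0 \<and> g k \<in> H}"

lemma avoids_sure_loss_gain_cone: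
  "avoids_sure_loss Z H Q \<longleftrightarrow> (\<forall>S\<in>gain_cone Z H Q. (SUP z\<in>Z. S z) \<ge> 0)"
proof -
  have *: "(SUP z\<in>Z. (\<lambda>z\<in>Z. F z) z) = (SUP z\<in>Z. F z)" for F :: "'a \<Rightarrow> real"
    by (intro SUP_cong) auto
  have ball: "(\<forall>S\<in>gain_cone Z H Q. \<Phi> S) \<longleftrightarrow>
      (\<forall>(n::nat) g c. (\<forall>k\<in>{1..n}. g k \<in> H \<and> c k \<ge> 0) \<longrightarrow>
        \<Phi> (\<lambda>z\<in>Z. \<Sum>k=1..n. c k * (g k z - Q (g k))))" (is "?l \<longleftrightarrow> ?r") for \<Phi>
  proof
    assume l: ?l
    show ?r by (intro allI impI bspec[OF l]) (unfold gain_cone_def, blast)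
  next
    assume r: ?r
    show ?l
    proof
      fix S assume "S \<in> gain_cone Z H Q"
      then obtain n :: nat and c g where "\<forall>k\<in>{1..n}. c k \<ge> 0 \<and> g k \<in> H"
        and S: "S = (\<lambda>z\<in>Z. \<Sum>k=1..n. c k * (g k z - Q (g k)))"
        unfolding gain_cone_def by blast
      then show "\<Phi> S" unfolding S by (intro r[rule_format]) auto
    qed
  qed
  show ?thesis
    unfolding avoids_sure_loss_def ball * ..
qed

lemma natural_extension_gain_cone:
  "natural_extension Z H Q h = (SUP S\<in>gain_cone Z H Q. INF z\<in>Z. h z - S z)"
proof -
  have *: "(INF z\<in>Z. h z - (\<lambda>z\<in>Z. F z) z) = (INF z\<in>Z. h z - F z)" for F :: "'a \<Rightarrow> real"
    by (intro INF_cong) auto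
  have image: "\<Phi> ` gain_cone Z H Q = {\<Phi> (\<lambda>z\<in>Z. \<Sum>k=1..n. c k * (g k z - Q (g k))) | (n::nat) c g.
      \<forall>k\<in>{1..n}. c k \<ge> 0 \<and> g k \<in> H}" for \<Phi> :: "'a gamble \<Rightarrow> real"
    unfolding gain_cone_def by blast
  show ?thesis
    unfolding natural_extension_def image * ..
qed

lemma gain_cone_zero: "(\<lambda>z\<in>Z. 0) \<in> gain_cone Z H Q"
  unfolding gain_cone_def mem_Collect_eq by (rule exI[of _ 0]) auto

lemma gain_cone_single:
  assumes "g \<in> H"
  shows "(\<lambda>z\<in>Z. g z - Q g) \<in> gain_cone Z H Q"
  unfolding gain_cone_def mem_Collect_eq
  using assms by (intro exI[of _ 1] exI[of _ "\<lambda>_. 1"] exI[of _ "\<lambda>_. g"]) auto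

lemma gain_cone_scale:
  assumes "S \<in> gain_cone Z H Q" "a \<ge> 0"
  shows "(\<lambda>z\<in>Z. a * S z) \<in> gain_cone Z H Q"
proof -
  obtain n :: nat and c g where "\<forall>k\<in>{1..n}. c k \<ge> 0 \<and> g k \<in> H"
    and "S = (\<lambda>z\<in>Z. \<Sum>k=1..n. c k * (g k z - Q (g k)))"
    using assms(1) unfolding gain_cone_def by blast
  then show ?thesis
    using assms(2) unfolding gain_cone_def mem_Collect_eq
    by (intro exI[of _ n] exI[of _ "\<lambda>k. a * c k"] exI[of _ g])
      (auto simp: sum_distrib_left mult.assoc intro!: restrict_ext)
qed

lemma gain_cone_add:
  assumes "S \<in> gain_cone Z H Q" "S' \<in> gain_cone Z H Q"
  shows "(\<lambda>z\<in>Z. S z + S' z) \<in> gain_cone Z H Q"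
proof -
  obtain n :: nat and c g where 1: "\<forall>k\<in>{1..n}. c k \<ge> 0 \<and> g k \<in> H"
    and S: "S = (\<lambda>z\<in>Z. \<Sum>k=1..n. c k * (g k z - Q (g k)))"
    using assms(1) unfolding gain_cone_def by blast
  obtain n' :: nat and c' g' where 2: "\<forall>k\<in>{1..n'}. c' k \<ge> 0 \<and> g' k \<in> H"
    and S': "S' = (\<lambda>z\<in>Z. \<Sum>k=1..n'. c' k * (g' k z - Q (g' k)))"
    using assms(2) unfolding gain_cone_def by blast
  \<comment> \<open>The second index sequence is shifted behind the first one.\<close>
  define d where "d k = (if k \<le> n then c k else c' (k - n))" for k
  define f where "f k = (if k \<le> n then g k else g' (k - n))" for k
  have split: "(\<Sum>k=1..n+n'. G k) = (\<Sum>k=1..n. G k) + (\<Sum>k=1..n'. G (k + n))"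
    for G :: "nat \<Rightarrow> real"
    using sum.ub_add_nat[of 1 n G n'] sum.shift_bounds_cl_nat_ivl[of G 1 n n']
    by (simp add: add.commute)
  have "(\<Sum>k=1..n+n'. d k * (f k z - Q (f k))) =
      (\<Sum>k=1..n. c k * (g k z - Q (g k))) + (\<Sum>k=1..n'. c' k * (g' k z - Q (g' k)))" for z
    unfolding split by (intro arg_cong2[of _ _ _ _ "(+)"] sum.cong) (auto simp: d_def f_def)
  then have "(\<lambda>z\<in>Z. S z + S' z) = (\<lambda>z\<in>Z. \<Sum>k=1..n+n'. d k * (f k z - Q (f k)))"
    unfolding S S' by auto
  moreover have "c' (k - n) \<ge> 0 \<and> g' (k - n) \<in> H" if "k \<in> {1..n+n'}" "\<not> k \<le> n" for k
    using that by (intro 2[rule_format]) auto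
  then have "\<forall>k\<in>{1..n+n'}. d k \<ge> 0 \<and> f k \<in> H"
    using 1 by (auto simp: d_def f_def)
  ultimately show ?thesis unfolding gain_cone_def by blast
qed

lemma gain_cone_gambles:
  assumes "H \<subseteq> gambles Z" "S \<in> gain_cone Z H Q"
  shows "S \<in> gambles Z"
proof -
  obtain n :: nat and c g where 1: "\<forall>k\<in>{1..n}. c k \<ge> 0 \<and> g k \<in> H"
    and S: "S = (\<lambda>z\<in>Z. \<Sum>k=1..n. c k * (g k z - Q (g k)))"
    using assms(2) unfolding gain_cone_def by blast
  let ?F = "\<lambda>k. \<lambda>z\<in>Z. c k * (\<lambda>z\<in>Z. g k z - (\<lambda>z\<in>Z. Q (g k)) z) z"
  have "S = (\<lambda>z\<in>Z. \<Sum>k=1..n. ?F k z)" unfolding S by auto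
  moreover have "?F k \<in> gambles Z" if "k \<in> {1..n}" for k
    using that 1 assms(1) by (intro gambles_scale gambles_diff gambles_const) auto
  ultimately show ?thesis using gambles_sum[of "{1..n}" ?F Z] by simp
qed

text \<open>
  Each generator \<open>g - Q g\<close> has price at least \<open>R g - Q g\<close>, which domination makes non-negative; the
  rest of the cone follows by homogeneity and superadditivity.
\<close>

lemma coherent_gain_cone:
  assumes Z: "Z \<noteq> {}" and R: "coherent Z R" and dom: "dominates H R Q"
    and H: "H \<subseteq> gambles Z" and S: "S \<in> gain_cone Z H Q"
  shows "R S \<ge> 0"
proof -
  obtain n :: nat and c g where 1: "\<forall>k\<in>{1..n}. c k \<ge> 0 \<and> g k \<in> H"
    and S: "S = (\<lambda>z\<in>Z. \<Sum>k=1..n. c k * (g k z - Q (g k)))"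
    using S unfolding gain_cone_def by blast
  let ?G = "\<lambda>k. \<lambda>z\<in>Z. g k z - (\<lambda>z\<in>Z. Q (g k)) z"
  let ?F = "\<lambda>k. \<lambda>z\<in>Z. c k * ?G k z"
  have G: "?G k \<in> gambles Z" if "k \<in> {1..n}" for k
    using that 1 H by (intro gambles_diff gambles_const) auto
  have "R (?G k) \<ge> 0" if k: "k \<in> {1..n}" for k
  proof -
    have gk: "g k \<in> gambles Z" using 1 H k by auto
    let ?C = "\<lambda>z\<in>Z. - Q (g k)"
    have "(INF z\<in>Z. ?C z) \<le> R ?C"
      using R gambles_const unfolding coherent_def by blast
    then have "- Q (g k) \<le> R ?C" using Z by simp
    moreover have "(\<lambda>z\<in>Z. ?G k z - g k z) = ?C" by auto
    ultimately have "R (g k) + - Q (g k) \<le> R (?G k)"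
      using coherent_add_diff_le[OF Z R gk G[OF k], of "- Q (g k)"] by simp
    moreover have "Q (g k) \<le> R (g k)" using dom 1 k unfolding dominates_def by auto
    ultimately show ?thesis by simp
  qed
  moreover have "R (?F k) = c k * R (?G k)" if k: "k \<in> {1..n}" for k
    using R G[OF k] 1 k unfolding coherent_def by blast
  ultimately have "0 \<le> (\<Sum>k=1..n. R (?F k))" using 1 by (intro sum_nonneg) auto
  also have "\<dots> \<le> R (\<lambda>z\<in>Z. \<Sum>k=1..n. ?F k z)"
    by (intro coherent_sum Z R gambles_scale G finite_atLeastAtMost)
  also have "(\<lambda>z\<in>Z. \<Sum>k=1..n. ?F k z) = S" unfolding S by auto
  finally show ?thesis .
qed

lemma coherent_dominating_avoids_sure_loss:
  assumes "Z \<noteq> {}" "coherent Z R" "dominates H R Q" "H \<subseteq> gambles Z"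
  shows "avoids_sure_loss Z H Q"
  unfolding avoids_sure_loss_gain_cone
proof
  fix S assume S: "S \<in> gain_cone Z H Q"
  then have "S \<in> gambles Z" using gain_cone_gambles assms(4) by blast
  then show "0 \<le> (SUP z\<in>Z. S z)"
    using coherent_gain_cone[OF assms S] coherent_le_SUP[OF assms(1,2), of S] by linarith
qed

text \<open>
  As \<open>R S \<ge> 0\<close> for every gain \<open>S\<close>, the value \<open>R h\<close> is at least \<open>R (h - S)\<close>, which is at least the
  infimum of \<open>h - S\<close>.
\<close>

lemma natural_extension_least:
  assumes Z: "Z \<noteq> {}" and R: "coherent Z R" and dom: "dominates H R Q"
    and H: "H \<subseteq> gambles Z" and h: "h \<in> gambles Z"
  shows "natural_extension Z H Q h \<le> R h"
  unfolding natural_extension_gain_cone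
proof (rule cSUP_least)
  show "gain_cone Z H Q \<noteq> {}" using gain_cone_zero by blast
  fix S assume S: "S \<in> gain_cone Z H Q"
  then have Sg: "S \<in> gambles Z" using gain_cone_gambles H by blast
  let ?D = "\<lambda>z\<in>Z. h z - S z"
  have "(INF z\<in>Z. ?D z) \<le> R ?D"
    using R gambles_diff[OF h Sg] unfolding coherent_def by blast
  moreover have "(INF z\<in>Z. ?D z) = (INF z\<in>Z. h z - S z)" by (intro INF_cong) auto
  ultimately have "R S + (INF z\<in>Z. h z - S z) \<le> R h"
    using coherent_add_diff_le[OF Z R Sg h] by simp
  then show "(INF z\<in>Z. h z - S z) \<le> R h"
    using coherent_gain_cone[OF Z R dom H S] by linarith
qed

lemma gambles_diff_bdd_below:
  assumes "f \<in> gambles Z" "g \<in> gambles Z"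
  shows "bdd_below ((\<lambda>z. f z - g z) ` Z)"
  using gambles_bdd(1)[OF gambles_diff[OF assms]] by (simp cong: image_cong)

text \<open>
  A real supremum says something only over a set that is bounded above, and this is where avoiding sure
  loss is needed: if \<open>h - S \<ge> i\<close> everywhere, then \<open>S \<le> sup h - i\<close>, whereas \<open>sup S \<ge> 0\<close>, so
  \<open>i \<le> sup h\<close>.
\<close>

lemma natural_extension_bounds:
  assumes Z: "Z \<noteq> {}" and asl: "avoids_sure_loss Z H Q"
    and H: "H \<subseteq> gambles Z" and h: "h \<in> gambles Z"
  shows natural_extension_le_SUP: "natural_extension Z H Q h \<le> (SUP z\<in>Z. h z)"
    and natural_extension_upper:
      "S \<in> gain_cone Z H Q \<Longrightarrow> (INF z\<in>Z. h z - S z) \<le> natural_extension Z H Q h"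
proof -
  have b: "(INF z\<in>Z. h z - S z) \<le> (SUP z\<in>Z. h z)" if S: "S \<in> gain_cone Z H Q" for S
  proof -
    let ?i = "INF z\<in>Z. h z - S z"
    have Sg: "S \<in> gambles Z" using S gain_cone_gambles H by blast
    have "(SUP z\<in>Z. S z) \<le> (SUP z\<in>Z. h z) - ?i"
    proof (rule cSUP_least[OF Z])
      fix z assume z: "z \<in> Z"
      have "?i \<le> h z - S z" by (rule cINF_lower[OF gambles_diff_bdd_below[OF h Sg] z])
      moreover have "h z \<le> (SUP z\<in>Z. h z)" by (rule cSUP_upper[OF z gambles_bdd(2)[OF h]])
      ultimately show "S z \<le> (SUP z\<in>Z. h z) - ?i" by linarith
    qed
    moreover have "0 \<le> (SUP z\<in>Z. S z)" using asl S unfolding avoids_sure_loss_gain_cone by blast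
    ultimately show ?thesis by linarith
  qed
  show "natural_extension Z H Q h \<le> (SUP z\<in>Z. h z)"
    unfolding natural_extension_gain_cone using gain_cone_zero b by (intro cSUP_least) blast+
  show "(INF z\<in>Z. h z - S z) \<le> natural_extension Z H Q h" if "S \<in> gain_cone Z H Q"
    unfolding natural_extension_gain_cone
    using that b by (intro cSUP_upper) (auto simp: bdd_above_def)
qed

lemma natural_extension_dominates:
  assumes "Z \<noteq> {}" "avoids_sure_loss Z H Q" "H \<subseteq> gambles Z"
  shows "dominates H (natural_extension Z H Q) Q"
  unfolding dominates_def
proof
  fix g assume g: "g \<in> H"
  have "(INF z\<in>Z. g z - (\<lambda>z\<in>Z. g z - Q g) z) = (INF z\<in>Z. Q g)"
    by (intro INF_cong) auto
  then show "Q g \<le> natural_extension Z H Q g"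
    using natural_extension_upper[OF assms, of g, OF _ gain_cone_single[OF g]] g assms by auto
qed

text \<open>
  Superadditivity and homogeneity reflect that the gains form a convex cone: lower bounds obtained with
  \<open>S\<close> for \<open>f\<close> and \<open>S'\<close> for \<open>g\<close> add up to one obtained with \<open>S + S'\<close> for \<open>f + g\<close>.
\<close>

lemma natural_extension_coherent:
  assumes Z: "Z \<noteq> {}" and asl: "avoids_sure_loss Z H Q" and H: "H \<subseteq> gambles Z"
  shows "coherent Z (natural_extension Z H Q)"
proof -
  let ?E = "natural_extension Z H Q"
  note upper = natural_extension_upper[OF Z asl H]
  have ne: "gain_cone Z H Q \<noteq> {}" using gain_cone_zero by blast
  have inf: "(INF z\<in>Z. f z) \<le> ?E f" if "f \<in> gambles Z" for f
  proof -
    have "(INF z\<in>Z. f z - (\<lambda>z\<in>Z. 0) z) = (INF z\<in>Z. f z)" by (intro INF_cong) auto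
    then show ?thesis using upper[OF that gain_cone_zero] by simp
  qed
  have scale_le: "c * ?E f \<le> ?E (\<lambda>z\<in>Z. c * f z)" if f: "f \<in> gambles Z" and c: "c > 0" for f c
  proof -
    let ?cf = "\<lambda>z\<in>Z. c * f z"
    have cf: "?cf \<in> gambles Z" using f by (rule gambles_scale)
    have "?E f \<le> ?E ?cf / c"
      unfolding natural_extension_gain_cone[of _ _ _ f]
    proof (rule cSUP_least[OF ne])
      fix S assume S: "S \<in> gain_cone Z H Q"
      then have Sg: "S \<in> gambles Z" using gain_cone_gambles H by blast
      let ?cS = "\<lambda>z\<in>Z. c * S z"
      have cS: "?cS \<in> gain_cone Z H Q" using S c by (intro gain_cone_scale) auto
      have "c * (INF z\<in>Z. f z - S z) \<le> (INF z\<in>Z. ?cf z - ?cS z)"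
      proof (rule cINF_greatest[OF Z])
        fix z assume z: "z \<in> Z"
        have "(INF z\<in>Z. f z - S z) \<le> f z - S z"
          by (rule cINF_lower[OF gambles_diff_bdd_below[OF f Sg] z])
        then have "c * (INF z\<in>Z. f z - S z) \<le> c * (f z - S z)"
          using c by (intro mult_left_mono) auto
        then show "c * (INF z\<in>Z. f z - S z) \<le> ?cf z - ?cS z"
          using z by (simp add: algebra_simps)
      qed
      also have "\<dots> \<le> ?E ?cf" by (rule upper[OF cf cS])
      finally show "(INF z\<in>Z. f z - S z) \<le> ?E ?cf / c" using c by (simp add: field_simps)
    qed
    then show ?thesis using c by (simp add: field_simps)
  qed
  have scale: "?E (\<lambda>z\<in>Z. c * f z) = c * ?E f" if f: "f \<in> gambles Z" and c: "c \<ge> 0" for f c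
  proof (cases "c = 0")
    case True
    have "?E (\<lambda>z\<in>Z. 0) = 0"
      using inf[OF gambles_const[of 0 Z]] natural_extension_le_SUP[OF Z asl H gambles_const[of 0 Z]] Z
      by simp
    then show ?thesis using True by simp
  next
    case False
    then have c: "c > 0" using c by simp
    \<comment> \<open>The reverse inequality is the same one for \<open>c f\<close> and the factor \<open>1/c\<close>.\<close>
    have "(\<lambda>z\<in>Z. (1/c) * (\<lambda>z\<in>Z. c * f z) z) = f"
      using f c by (auto simp: gambles_iff extensional_def)
    then have "(1/c) * ?E (\<lambda>z\<in>Z. c * f z) \<le> ?E f"
      using scale_le[OF gambles_scale[OF f, of c], of "1/c"] c by simp
    then show ?thesis using scale_le[OF f c] c by (simp add: field_simps)
  qed
  have add: "?E f + ?E g \<le> ?E (\<lambda>z\<in>Z. f z + g z)"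
    if f: "f \<in> gambles Z" and g: "g \<in> gambles Z" for f g
  proof -
    let ?fg = "\<lambda>z\<in>Z. f z + g z"
    have fg: "?fg \<in> gambles Z" using f g by (rule gambles_add)
    have *: "(INF z\<in>Z. f z - S z) + (INF z\<in>Z. g z - S' z) \<le> ?E ?fg"
      if S: "S \<in> gain_cone Z H Q" and S': "S' \<in> gain_cone Z H Q" for S S'
    proof -
      let ?T = "\<lambda>z\<in>Z. S z + S' z"
      have Sg: "S \<in> gambles Z" "S' \<in> gambles Z" using S S' gain_cone_gambles H by blast+
      have "(INF z\<in>Z. f z - S z) + (INF z\<in>Z. g z - S' z) \<le> (INF z\<in>Z. ?fg z - ?T z)"
      proof (rule cINF_greatest[OF Z])
        fix z assume z: "z \<in> Z"
        have "(INF z\<in>Z. f z - S z) \<le> f z - S z" "(INF z\<in>Z. g z - S' z) \<le> g z - S' z"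
          using cINF_lower[OF gambles_diff_bdd_below[OF f Sg(1)] z]
            cINF_lower[OF gambles_diff_bdd_below[OF g Sg(2)] z] by auto
        then show "(INF z\<in>Z. f z - S z) + (INF z\<in>Z. g z - S' z) \<le> ?fg z - ?T z"
          using z by simp
      qed
      also have "\<dots> \<le> ?E ?fg" by (rule upper[OF fg gain_cone_add[OF S S']])
      finally show ?thesis .
    qed
    have "?E f \<le> ?E ?fg - (INF z\<in>Z. g z - S' z)" if S': "S' \<in> gain_cone Z H Q" for S'
      unfolding natural_extension_gain_cone[of _ _ _ f]
      using *[OF _ S'] by (intro cSUP_least[OF ne]) (simp add: le_diff_eq)
    then have "?E g \<le> ?E ?fg - ?E f"
      unfolding natural_extension_gain_cone[of _ _ _ g]
      by (intro cSUP_least[OF ne]) (simp add: le_diff_eq add.commute)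
    then show ?thesis by simp
  qed
  show ?thesis unfolding coherent_def using inf scale add by blast
qed


section \<open>Count vectors and permutations\<close>

lemma finite_samples: "finite X \<Longrightarrow> finite (samples X N)"
  by (simp add: samples_def finite_PiE)

lemma samples_nonempty: "X \<noteq> {} \<Longrightarrow> samples X N \<noteq> {}"
  by (simp add: samples_def PiE_eq_empty_iff)

lemma counting_map_in_count_vectors:
  assumes "finite X" "z \<in> samples X N"
  shows "counting_map X N z \<in> count_vectors X N"
proof -
  have "(\<Sum>x\<in>X. card {k \<in> {1..N}. z k = x}) = card (\<Union>x\<in>X. {k \<in> {1..N}. z k = x})"
    using assms(1) by (subst card_UN_disjoint) auto
  also have "(\<Union>x\<in>X. {k \<in> {1..N}. z k = x}) = {1..N}"
    using assms(2) by (auto simp: samples_def)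
  finally show ?thesis by (simp add: count_vectors_def counting_map_def)
qed

text \<open>
  The set \<open>?S\<close> of the proof has \<open>m x\<close> tagged copies of each \<open>x\<close>, hence \<open>N\<close> elements; numbering these
  from 1 to \<open>N\<close> and forgetting the tags gives a sample with count vector \<open>m\<close>.
\<close>

lemma count_class_nonempty:
  assumes "finite X" "m \<in> count_vectors X N"
  shows "count_class X N m \<noteq> {}"
proof -
  let ?S = "Sigma X (\<lambda>x. {..<m x})"
  have "card ?S = N" "finite ?S"
    using assms by (auto simp: count_vectors_def card_SigmaI)
  then obtain b where b: "bij_betw b {1..N} ?S"
    using finite_same_card_bij[of "{1..N}" ?S] by auto
  define z where "z = (\<lambda>k\<in>{1..N}. fst (b k))"
  have "b k \<in> ?S" if "k \<in> {1..N}" for k using b that by (rule bij_betwE[THEN bspec])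
  then have z: "z \<in> samples X N"
    by (fastforce simp: samples_def z_def)
  have "card {k \<in> {1..N}. z k = x} = m x" if x: "x \<in> X" for x
  proof -
    have "b ` {k \<in> {1..N}. z k = x} = {p \<in> b ` {1..N}. fst p = x}"
      by (auto simp: z_def)
    also have "\<dots> = {x} \<times> {..<m x}"
      using b x by (auto simp: bij_betw_def)
    finally have "card (b ` {k \<in> {1..N}. z k = x}) = m x" by simp
    moreover have "inj_on b {k \<in> {1..N}. z k = x}"
      using b by (auto simp: bij_betw_def intro: inj_on_subset)
    ultimately show ?thesis by (simp add: card_image)
  qed
  then have "counting_map X N z = m"
    using assms(2) by (auto simp: counting_map_def count_vectors_def PiE_def extensional_def)
  with z show ?thesis by (auto simp: count_class_def)
qed

lemma counting_map_image:
  assumes "finite X"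
  shows "counting_map X N ` samples X N = count_vectors X N"
  using counting_map_in_count_vectors[OF assms] count_class_nonempty[OF assms]
  by (fastforce simp: count_class_def)

lemma finite_count_vectors: "finite X \<Longrightarrow> finite (count_vectors X N)"
  by (metis counting_map_image finite_imageI finite_samples)

lemma count_vectors_nonempty: "finite X \<Longrightarrow> X \<noteq> {} \<Longrightarrow> count_vectors X N \<noteq> {}"
  by (metis counting_map_image image_is_empty samples_nonempty)

lemma finite_count_class: "finite X \<Longrightarrow> finite (count_class X N m)"
  by (simp add: count_class_def finite_samples)

lemma card_count_class_pos:
  "finite X \<Longrightarrow> m \<in> count_vectors X N \<Longrightarrow> card (count_class X N m) > 0"
  by (simp add: card_gt_0_iff finite_count_class count_class_nonempty)

lemma samples_permute:
  assumes "z \<in> samples X N" "\<pi> permutes {1..N}"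
  shows "z \<circ> \<pi> \<in> samples X N"
proof -
  have "z (\<pi> k) \<in> X" if "k \<in> {1..N}" for k
    using assms that permutes_in_image[OF assms(2), of k] by (auto simp: samples_def)
  moreover have "z (\<pi> k) = undefined" if "k \<notin> {1..N}" for k
    using assms that permutes_not_in[OF assms(2), of k] by (auto simp: samples_def)
  ultimately show ?thesis by (auto simp: samples_def)
qed

lemma counting_map_permute:
  assumes "\<pi> permutes {1..N}"
  shows "counting_map X N (z \<circ> \<pi>) = counting_map X N z"
proof -
  have "card {k \<in> {1..N}. (z \<circ> \<pi>) k = x} = card {k \<in> {1..N}. z k = x}" for x
  proof -
    have "\<pi> ` {k \<in> {1..N}. (z \<circ> \<pi>) k = x} = {k \<in> \<pi> ` {1..N}. z k = x}" by auto
    also have "\<dots> = {k \<in> {1..N}. z k = x}" by (simp only: permutes_image[OF assms])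
    finally show ?thesis
      using card_image[OF inj_on_subset[OF permutes_inj[OF assms] subset_UNIV]] by metis
  qed
  then show ?thesis by (simp add: counting_map_def)
qed

lemma bij_betw_permute_count_class:
  assumes "\<pi> permutes {1..N}"
  shows "bij_betw (\<lambda>z. z \<circ> \<pi>) (count_class X N m) (count_class X N m)"
proof (rule bij_betw_byWitness[where f' = "\<lambda>z. z \<circ> inv \<pi>"])
  note inv = permutes_inv[OF assms]
  show "\<forall>z\<in>count_class X N m. (z \<circ> \<pi>) \<circ> inv \<pi> = z"
    by (simp add: comp_assoc permutes_inv_o[OF assms])
  show "\<forall>z\<in>count_class X N m. (z \<circ> inv \<pi>) \<circ> \<pi> = z"
    by (simp add: comp_assoc permutes_inv_o[OF assms])
  show "(\<lambda>z. z \<circ> \<pi>) ` count_class X N m \<subseteq> count_class X N m"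
    using samples_permute[OF _ assms] counting_map_permute[OF assms] by (auto simp: count_class_def)
  show "(\<lambda>z. z \<circ> inv \<pi>) ` count_class X N m \<subseteq> count_class X N m"
    using samples_permute[OF _ inv] counting_map_permute[OF inv] by (auto simp: count_class_def)
qed

text \<open>
  Equal counts mean that the two samples list the same multiset, so some permutation of the positions
  carries one to the other. Outside of the positions both are \<^const>\<open>undefined\<close> and the permutation
  is the identity, which makes the equation hold for the total functions.
\<close>

lemma same_counts_imp_permutation:
  assumes "z \<in> samples X N" "w \<in> samples X N" "counting_map X N z = counting_map X N w"
  obtains \<pi> where "\<pi> permutes {1..N}" "z = w \<circ> \<pi>"
proof -
  have "card {k \<in> {1..N}. z k = x} = card {k \<in> {1..N}. w k = x}" for x
  proof (cases "x \<in> X")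
    case True
    then show ?thesis using fun_cong[OF assms(3), of x] by (simp add: counting_map_def)
  next
    case False
    then have "{k \<in> {1..N}. z k = x} = {}" "{k \<in> {1..N}. w k = x} = {}"
      using assms(1,2) by (auto simp: samples_def)
    then show ?thesis by (simp only:)
  qed
  then have "image_mset z (mset_set {1..N}) = image_mset w (mset_set {1..N})"
    by (intro multiset_eqI) (simp add: count_image_mset_eq_card_vimage)
  then obtain \<pi> where \<pi>: "\<pi> permutes {1..N}" "\<forall>k\<in>{1..N}. z k = w (\<pi> k)"
    using image_mset_eq_implies_permutes[of "{1..N}" z w] by auto
  have "z k = (w \<circ> \<pi>) k" for k
  proof (cases "k \<in> {1..N}")
    case False
    then show ?thesis
      using assms(1,2) permutes_not_in[OF \<pi>(1) False] by (auto simp: samples_def PiE_def extensional_def)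
  qed (use \<pi>(2) in auto)
  then show thesis using that \<pi>(1) by blast
qed

text \<open>
  Sum \<open>f (w \<circ> \<pi>)\<close> over all \<open>w\<close> in the count class of \<open>z\<close> and all \<open>\<pi>\<close>. For fixed \<open>w\<close> the sum over
  \<open>\<pi>\<close> is the same as for \<open>z\<close>, because \<open>w = z \<circ> \<sigma>\<close> for some \<open>\<sigma>\<close>; for fixed \<open>\<pi>\<close> the sum over \<open>w\<close> is
  the sum of \<open>f\<close> over the class, which \<open>\<pi>\<close> permutes.
\<close>

lemma MuHy_counting_map_eq_average:
  assumes X: "finite X" and z: "z \<in> samples X N"
  shows "MuHy X N f (counting_map X N z) =
    (\<Sum>\<pi> | \<pi> permutes {1..N}. f (z \<circ> \<pi>)) / fact N"
proof -
  let ?m = "counting_map X N z" and ?\<Pi> = "{\<pi>. \<pi> permutes {1..N}}"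
  let ?C = "count_class X N ?m"
  have m: "?m \<in> count_vectors X N" by (rule counting_map_in_count_vectors[OF X z])
  have orbit: "(\<Sum>\<pi>\<in>?\<Pi>. f (w \<circ> \<pi>)) = (\<Sum>\<pi>\<in>?\<Pi>. f (z \<circ> \<pi>))" if w: "w \<in> ?C" for w
  proof -
    obtain \<sigma> where \<sigma>: "\<sigma> permutes {1..N}" "w = z \<circ> \<sigma>"
      using same_counts_imp_permutation[of w X N z] w z by (auto simp: count_class_def)
    show ?thesis
      using setum_permutations_compose_left[OF \<sigma>(1), of "\<lambda>\<pi>. f (z \<circ> \<pi>)"]
      by (simp add: \<sigma>(2) comp_assoc)
  qed
  have "real (card ?C) * (\<Sum>\<pi>\<in>?\<Pi>. f (z \<circ> \<pi>)) = (\<Sum>w\<in>?C. \<Sum>\<pi>\<in>?\<Pi>. f (w \<circ> \<pi>))"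
    using orbit by simp
  also have "\<dots> = (\<Sum>\<pi>\<in>?\<Pi>. \<Sum>w\<in>?C. f (w \<circ> \<pi>))" by (rule sum.swap)
  also have "\<dots> = (\<Sum>\<pi>\<in>?\<Pi>. \<Sum>w\<in>?C. f w)"
    using bij_betw_permute_count_class
    by (intro sum.cong refl sum.reindex_bij_betw[where g = f]) auto
  also have "\<dots> = fact N * (\<Sum>w\<in>?C. f w)"
    using card_permutations[of "{1..N}" N] by simp
  finally show ?thesis
    using m card_count_class_pos[OF X m] by (simp add: MuHy_def field_simps)
qed


section \<open>The correspondence between samples and counts\<close>

lemma MuHy_gambles: "finite X \<Longrightarrow> MuHy X N f \<in> gambles (count_vectors X N)"
  by (simp add: gambles_finite finite_count_vectors MuHy_def)

lemma in_count_class_samples: "z \<in> count_class X N m \<Longrightarrow> z \<in> samples X N"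
  by (simp add: count_class_def)

lemma MuHy_add:
  "MuHy X N (\<lambda>z\<in>samples X N. f z + g z) =
     (\<lambda>m\<in>count_vectors X N. MuHy X N f m + MuHy X N g m)"
  by (auto simp: MuHy_def in_count_class_samples sum.distrib add_divide_distrib intro!: restrict_ext
      cong: sum.cong)

lemma MuHy_scale:
  "MuHy X N (\<lambda>z\<in>samples X N. c * f z) = (\<lambda>m\<in>count_vectors X N. c * MuHy X N f m)"
  by (auto simp: MuHy_def in_count_class_samples sum_distrib_left[symmetric] intro!: restrict_ext
      cong: sum.cong)

lemma MuHy_permute_diff:
  assumes "\<pi> permutes {1..N}"
  shows "MuHy X N (\<lambda>z\<in>samples X N. permute_gamble X N \<pi> f z - f z) = (\<lambda>m\<in>count_vectors X N. 0)"
proof -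
  have "(\<Sum>z\<in>count_class X N m. (\<lambda>z\<in>samples X N. permute_gamble X N \<pi> f z - f z) z) =
      (\<Sum>z\<in>count_class X N m. f (z \<circ> \<pi>)) - (\<Sum>z\<in>count_class X N m. f z)" for m
    by (simp add: in_count_class_samples permute_gamble_def sum_subtractf cong: sum.cong)
  also have "\<dots> m = 0" for m
    using sum.reindex_bij_betw[OF bij_betw_permute_count_class[OF assms], of f X m] by simp
  finally show ?thesis by (simp add: MuHy_def)
qed

lemma INF_le_MuHy:
  assumes X: "finite X" and m: "m \<in> count_vectors X N"
  shows "(INF z\<in>samples X N. f z) \<le> MuHy X N f m"
proof -
  let ?C = "count_class X N m"
  have "real (card ?C) * (INF z\<in>samples X N. f z) = (\<Sum>z\<in>?C. (INF z\<in>samples X N. f z))" by simp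
  also have "\<dots> \<le> (\<Sum>z\<in>?C. f z)"
    using finite_samples[OF X]
    by (intro sum_mono cINF_lower bdd_below_finite) (auto simp: count_class_def)
  finally show ?thesis
    using m card_count_class_pos[OF X m] by (simp add: MuHy_def field_simps)
qed

lemma MuHy_comp_counting_map:
  assumes "finite X" "h \<in> gambles (count_vectors X N)"
  shows "MuHy X N (\<lambda>z\<in>samples X N. h (counting_map X N z)) = h"
proof
  fix m
  show "MuHy X N (\<lambda>z\<in>samples X N. h (counting_map X N z)) m = h m"
  proof (cases "m \<in> count_vectors X N")
    case True
    have "(\<Sum>z\<in>count_class X N m. (\<lambda>z\<in>samples X N. h (counting_map X N z)) z) =
        (\<Sum>z\<in>count_class X N m. h m)"
      by (intro sum.cong) (auto simp: count_class_def)
    then show ?thesis using True card_count_class_pos[OF assms(1) True]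
      by (simp add: MuHy_def)
  next
    case False
    then show ?thesis using assms(2) by (simp add: MuHy_def gambles_iff extensional_def)
  qed
qed

lemma comp_counting_map_gambles:
  "finite X \<Longrightarrow> (\<lambda>z\<in>samples X N. h (counting_map X N z)) \<in> gambles (samples X N)"
  by (simp add: gambles_finite finite_samples)

lemma coherent_count_distribution:
  assumes X: "finite X" "X \<noteq> {}" and R: "coherent (samples X N) R"
  shows "coherent (count_vectors X N) (count_distribution X N R)"
proof -
  let ?Z = "samples X N" and ?M = "count_vectors X N"
  let ?T = "counting_map X N"
  let ?c = "\<lambda>h. \<lambda>z\<in>?Z. h (?T z) :: real"
  have T: "?T z \<in> ?M" if "z \<in> ?Z" for z using counting_map_in_count_vectors[OF X(1) that] .
  have g: "?c h \<in> gambles ?Z" for h by (rule comp_counting_map_gambles[OF X(1)])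
  have inf: "(INF m\<in>?M. h m) \<le> R (?c h)" for h
  proof -
    have "(INF m\<in>?M. h m) \<le> (INF z\<in>?Z. ?c h z)"
      using samples_nonempty[OF X(2)] finite_count_vectors[OF X(1)] T
      by (intro cINF_greatest) (auto intro!: cINF_lower bdd_below_finite)
    also have "\<dots> \<le> R (?c h)" using R g unfolding coherent_def by blast
    finally show ?thesis .
  qed
  have scale: "R (?c (\<lambda>m\<in>?M. c * h m)) = c * R (?c h)" if "c \<ge> 0" for c h
  proof -
    have "?c (\<lambda>m\<in>?M. c * h m) = (\<lambda>z\<in>?Z. c * ?c h z)" using T by auto
    moreover have "R (\<lambda>z\<in>?Z. c * ?c h z) = c * R (?c h)"
      using R g[of h] that unfolding coherent_def by blast
    ultimately show ?thesis by simp
  qed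
  have add: "R (?c h) + R (?c h') \<le> R (?c (\<lambda>m\<in>?M. h m + h' m))" for h h'
  proof -
    have "?c (\<lambda>m\<in>?M. h m + h' m) = (\<lambda>z\<in>?Z. ?c h z + ?c h' z)" using T by auto
    moreover have "R (?c h) + R (?c h') \<le> R (\<lambda>z\<in>?Z. ?c h z + ?c h' z)"
      using R g[of h] g[of h'] unfolding coherent_def by blast
    ultimately show ?thesis by simp
  qed
  show ?thesis
    unfolding coherent_def count_distribution_def using inf scale add by blast
qed

text \<open>
  \<^const>\<open>MuHy\<close> is linear and takes averages, so each coherence axiom pulls back along it.
\<close>

lemma coherent_MuHy:
  assumes X: "finite X" "X \<noteq> {}" and Q: "coherent (count_vectors X N) Q"
  shows "coherent (samples X N) (\<lambda>f. Q (MuHy X N f))"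
proof -
  let ?Z = "samples X N" and ?M = "count_vectors X N"
  note g = MuHy_gambles[OF X(1), of N]
  have inf: "(INF z\<in>?Z. f z) \<le> Q (MuHy X N f)" for f
  proof -
    have "(INF z\<in>?Z. f z) \<le> (INF m\<in>?M. MuHy X N f m)"
      using count_vectors_nonempty[OF X] by (intro cINF_greatest INF_le_MuHy[OF X(1)])
    also have "\<dots> \<le> Q (MuHy X N f)" using Q g unfolding coherent_def by blast
    finally show ?thesis .
  qed
  show ?thesis
    unfolding coherent_def MuHy_add MuHy_scale
    using inf Q g unfolding coherent_def by blast
qed

lemma exchangeable_MuHy:
  assumes "coherent (count_vectors X N) Q"
  shows "exchangeable X N (\<lambda>f. Q (MuHy X N f))"
  unfolding exchangeable_def by (intro ballI allI impI) (simp only: MuHy_permute_diff coherent_zero[OF assms] order_refl)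

text \<open>
  The gain is the average of the gambles \<open>\<pi> f - f\<close>, all of which have non-negative price by
  exchangeability.
\<close>

lemma exchangeable_class_average_gain_nonneg:
  assumes X: "finite X" "X \<noteq> {}" and R: "coherent (samples X N) R" "exchangeable X N R"
    and f: "f \<in> gambles (samples X N)"
  shows "R (\<lambda>z\<in>samples X N. MuHy X N f (counting_map X N z) - f z) \<ge> 0"
proof -
  let ?Z = "samples X N" and ?\<Pi> = "{\<pi>. \<pi> permutes {1..N}}"
  let ?D = "\<lambda>\<pi>. \<lambda>z\<in>?Z. permute_gamble X N \<pi> f z - f z"
  let ?F = "\<lambda>\<pi>. \<lambda>z\<in>?Z. (1 / fact N) * ?D \<pi> z"
  have D: "?D \<pi> \<in> gambles ?Z" for \<pi> by (simp add: gambles_finite finite_samples X(1))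
  have card: "card ?\<Pi> = fact N" by (rule card_permutations) auto
  have "R (?F \<pi>) \<ge> 0" if "\<pi> \<in> ?\<Pi>" for \<pi>
  proof -
    have "R (?F \<pi>) = (1 / fact N) * R (?D \<pi>)"
      using R(1) D[of \<pi>] unfolding coherent_def by (meson fact_ge_zero zero_le_divide_1_iff)
    moreover have "R (?D \<pi>) \<ge> 0" using R(2) f that unfolding exchangeable_def by blast
    ultimately show ?thesis by simp
  qed
  then have "0 \<le> (\<Sum>\<pi>\<in>?\<Pi>. R (?F \<pi>))" by (rule sum_nonneg)
  also have "\<dots> \<le> R (\<lambda>z\<in>?Z. \<Sum>\<pi>\<in>?\<Pi>. ?F \<pi> z)"
    by (intro coherent_sum samples_nonempty X R(1) gambles_scale D finite_permutations
        finite_atLeastAtMost)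
  also have "(\<lambda>z\<in>?Z. \<Sum>\<pi>\<in>?\<Pi>. ?F \<pi> z) = (\<lambda>z\<in>?Z. MuHy X N f (counting_map X N z) - f z)"
  proof (rule restrict_ext)
    fix z assume z: "z \<in> ?Z"
    have "(\<Sum>\<pi>\<in>?\<Pi>. ?F \<pi> z) = (\<Sum>\<pi>\<in>?\<Pi>. f (z \<circ> \<pi>) / fact N) - (\<Sum>\<pi>\<in>?\<Pi>. f z / fact N)"
      using z by (simp add: permute_gamble_def diff_divide_distrib sum_subtractf)
    also have "\<dots> = (\<Sum>\<pi>\<in>?\<Pi>. f (z \<circ> \<pi>)) / fact N - f z"
      using card by (simp add: sum_divide_distrib)
    finally show "(\<Sum>\<pi>\<in>?\<Pi>. ?F \<pi> z) = MuHy X N f (counting_map X N z) - f z"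
      by (simp only: MuHy_counting_map_eq_average[OF X(1) z])
  qed
  finally show ?thesis .
qed

text \<open>
  Exchangeability gives one inequality when applied to \<open>f\<close>; the other one comes from \<open>-f\<close>, because
  averaging over classes commutes with negation.
\<close>

lemma exchangeable_eq_count_distribution:
  assumes X: "finite X" "X \<noteq> {}" and R: "coherent (samples X N) R" "exchangeable X N R"
    and f: "f \<in> gambles (samples X N)"
  shows "R f = count_distribution X N R (MuHy X N f)"
proof -
  let ?Z = "samples X N" and ?T = "counting_map X N"
  let ?A = "\<lambda>z\<in>?Z. MuHy X N f (?T z)" and ?n = "\<lambda>z\<in>?Z. (-1) * f z"
  have A: "?A \<in> gambles ?Z" by (rule comp_counting_map_gambles[OF X(1)])
  note Z = samples_nonempty[OF X(2), of N]
  have "(\<lambda>z\<in>?Z. ?A z - f z) = (\<lambda>z\<in>?Z. MuHy X N f (?T z) - f z)" by auto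
  then have "R f + 0 \<le> R ?A"
    using exchangeable_class_average_gain_nonneg[OF X R f] by (intro coherent_add_diff_le[OF Z R(1) f A]) simp
  moreover have "(\<lambda>z\<in>?Z. f z - ?A z) = (\<lambda>z\<in>?Z. MuHy X N ?n (?T z) - ?n z)"
    unfolding MuHy_scale using counting_map_in_count_vectors[OF X(1)] by (intro restrict_ext) simp
  then have "R ?A + 0 \<le> R f"
    using exchangeable_class_average_gain_nonneg[OF X R gambles_scale[OF f, of "-1"]]
    by (intro coherent_add_diff_le[OF Z R(1) A f]) simp
  ultimately show ?thesis by (simp add: count_distribution_def)
qed


section \<open>Exchangeable natural extension\<close>

text \<open>
  Domination bounds the extended-real supremum from above by a real number, and each of its members
  bounds it from below.
\<close>

lemma dominated_count_assessment:
  assumes R: "\<And>f. f \<in> K \<Longrightarrow> P f \<le> Q' (MuHy X N f)" and g: "g \<in> count_domain X N K"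
  shows "\<bar>count_assessment X N K P g\<bar> \<noteq> \<infinity>" "count_lower_prevision X N K P g \<le> Q' g"
proof -
  obtain f where f: "f \<in> K" "MuHy X N f = g" using g by (auto simp: count_domain_def)
  have "ereal (P f) \<le> count_assessment X N K P g"
    unfolding count_assessment_def using f by (intro SUP_upper) auto
  moreover have "count_assessment X N K P g \<le> ereal (Q' g)"
    unfolding count_assessment_def using R by (intro SUP_least) auto
  ultimately show "\<bar>count_assessment X N K P g\<bar> \<noteq> \<infinity>" "count_lower_prevision X N K P g \<le> Q' g"
    unfolding count_lower_prevision_def by (cases "count_assessment X N K P g"; auto)+
qed

lemma le_count_lower_prevision:
  assumes "\<bar>count_assessment X N K P (MuHy X N f)\<bar> \<noteq> \<infinity>" "f \<in> K"
  shows "P f \<le> count_lower_prevision X N K P (MuHy X N f)"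
proof -
  have "ereal (P f) \<le> count_assessment X N K P (MuHy X N f)"
    unfolding count_assessment_def using assms(2) by (intro SUP_upper) auto
  then show ?thesis
    using assms(1) unfolding count_lower_prevision_def
    by (cases "count_assessment X N K P (MuHy X N f)") auto
qed

theorem theorem7:
  fixes X :: "'a set" and N :: nat
    and K :: "(nat \<Rightarrow> 'a) gamble set" and P :: "(nat \<Rightarrow> 'a) lower_prevision"
  assumes "finite X" and "X \<noteq> {}" and "N \<ge> 1"
    and "K \<subseteq> gambles (samples X N)"
  shows
    "(dominating_exchangeable X N K P \<noteq> {} \<longleftrightarrow>
        (\<forall>g\<in>count_domain X N K. \<bar>count_assessment X N K P g\<bar> \<noteq> \<infinity>) \<and>
        avoids_sure_loss (count_vectors X N) (count_domain X N K) (count_lower_prevision X N K P)) \<and>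
     (dominating_exchangeable X N K P \<noteq> {} \<longrightarrow>
        (\<exists>E. is_exchangeable_natural_extension X N K P E) \<and>
        (\<forall>E. is_exchangeable_natural_extension X N K P E \<longrightarrow>
           (\<forall>f\<in>gambles (samples X N).
              E f = natural_extension (count_vectors X N) (count_domain X N K)
                      (count_lower_prevision X N K P) (MuHy X N f)) \<and>
           (\<forall>h\<in>gambles (count_vectors X N).
              count_distribution X N E h =
                natural_extension (count_vectors X N) (count_domain X N K)
                  (count_lower_prevision X N K P) h)))"
proof -
  let ?Z = "samples X N" and ?M = "count_vectors X N"
  let ?D = "dominating_exchangeable X N K P" and ?H = "count_domain X N K"
  let ?Q = "count_lower_prevision X N K P"
  let ?fin = "\<forall>g\<in>?H. \<bar>count_assessment X N K P g\<bar> \<noteq> \<infinity>"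
  let ?ne = "natural_extension ?M ?H ?Q"
  let ?E = "\<lambda>f. ?ne (MuHy X N f)"
  note X = assms(1,2) and K = assms(4)
  have M: "?M \<noteq> {}" by (rule count_vectors_nonempty[OF X])
  have H: "?H \<subseteq> gambles ?M" using MuHy_gambles[OF X(1)] by (auto simp: count_domain_def)
  have to_counts: ?fin "coherent ?M (count_distribution X N R)"
    "dominates ?H (count_distribution X N R) ?Q" if R: "R \<in> ?D" for R
  proof -
    have co: "coherent ?Z R" and ex: "exchangeable X N R" and dom: "dominates K R P"
      using R by (auto simp: dominating_exchangeable_def)
    have "P f \<le> count_distribution X N R (MuHy X N f)" if "f \<in> K" for f
      using that dom exchangeable_eq_count_distribution[OF X co ex subsetD[OF K that]]
      unfolding dominates_def by metis
    from dominated_count_assessment[where Q' = "count_distribution X N R", OF this]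
    show ?fin "dominates ?H (count_distribution X N R) ?Q"
      by (simp_all add: dominates_def)
    show "coherent ?M (count_distribution X N R)" by (rule coherent_count_distribution[OF X co])
  qed
  have necessary: "?fin \<and> avoids_sure_loss ?M ?H ?Q" if "R \<in> ?D" for R
    using to_counts[OF that] coherent_dominating_avoids_sure_loss[OF M to_counts(2,3)[OF that] H]
    by blast
  have E: "?E \<in> ?D" if fin: ?fin and asl: "avoids_sure_loss ?M ?H ?Q"
  proof -
    have co: "coherent ?M ?ne" by (rule natural_extension_coherent[OF M asl H])
    have "P f \<le> ?E f" if f: "f \<in> K" for f
    proof -
      have g: "MuHy X N f \<in> ?H" using f by (simp add: count_domain_def)
      then have "P f \<le> ?Q (MuHy X N f)" using fin f by (intro le_count_lower_prevision) auto
      also have "\<dots> \<le> ?E f"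
        using natural_extension_dominates[OF M asl H] g unfolding dominates_def by blast
      finally show ?thesis .
    qed
    then show ?thesis
      using coherent_MuHy[OF X co] exchangeable_MuHy[OF co]
      by (simp add: dominating_exchangeable_def dominates_def)
  qed
  have least: "?E f \<le> R f" if R: "R \<in> ?D" and f: "f \<in> gambles ?Z" for R f
  proof -
    have "?E f \<le> count_distribution X N R (MuHy X N f)"
      by (rule natural_extension_least[OF M to_counts(2,3)[OF R] H MuHy_gambles[OF X(1)]])
    also have "\<dots> = R f"
      using R exchangeable_eq_count_distribution[OF X _ _ f]
      by (simp add: dominating_exchangeable_def)
    finally show ?thesis .
  qed
  have iff: "?D \<noteq> {} \<longleftrightarrow> ?fin \<and> avoids_sure_loss ?M ?H ?Q"
  proof
    assume "?D \<noteq> {}"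
    then obtain R where "R \<in> ?D" by auto
    then show "?fin \<and> avoids_sure_loss ?M ?H ?Q" by (rule necessary)
  next
    assume "?fin \<and> avoids_sure_loss ?M ?H ?Q"
    then have "?E \<in> ?D" by (elim conjE) (rule E)
    then show "?D \<noteq> {}" by (rule ex_in_conv[THEN iffD1, OF exI])
  qed
  have E_extension: "is_exchangeable_natural_extension X N K P ?E" if ne: "?D \<noteq> {}"
    unfolding is_exchangeable_natural_extension_def
  proof (intro conjI ballI)
    show "?E \<in> ?D" using iff[THEN iffD1, OF ne] by (elim conjE) (rule E)
  qed (rule least)
  have eq: "E' f = ?E f" if ne: "?D \<noteq> {}" and E': "is_exchangeable_natural_extension X N K P E'"
    and f: "f \<in> gambles ?Z" for E' f
  proof (rule antisym)
    have E'_D: "E' \<in> ?D" and E'_least: "\<And>R. R \<in> ?D \<Longrightarrow> E' f \<le> R f"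
      using E' f by (simp_all add: is_exchangeable_natural_extension_def)
    show "E' f \<le> ?E f"
      using E_extension[OF ne] by (intro E'_least) (simp add: is_exchangeable_natural_extension_def)
    show "?E f \<le> E' f" by (rule least[OF E'_D f])
  qed
  have eq_counts: "count_distribution X N E' h = ?ne h"
    if "?D \<noteq> {}" "is_exchangeable_natural_extension X N K P E'" "h \<in> gambles ?M" for E' h
    using eq[OF that(1,2) comp_counting_map_gambles[OF X(1)], of h]
      MuHy_comp_counting_map[OF X(1) that(3)]
    by (simp add: count_distribution_def)
  show ?thesis
    by (intro conjI impI allI ballI iff exI[where x = ?E] E_extension eq eq_counts)
qed

end
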